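(* Let $p>r\geq 2$ be integers, and define the multisets $$A=\{\pm(pr-1),\pm(p+r)\},\qquad B=\{\pm(pr+1),\pm(p-r)\}.$$ Then $A$ and $B$ form a nontrivial degree-three Prouhet--Tarry--Escott solution.
   Context: The notation $\{\pm x,\pm y\}$ means the four-element multiset $\{x,-x,y,-y\}$. Two four-element multisets of integers $A,B$ form a degree-three Prouhet--Tarry--Escott solution if $\sum_{a\in A}a^\ell=\sum_{b\in B}b^\ell$ for $\ell=1,2,3$ (with multiplicity); the solution is nontrivial if $A\neq B$ as multisets. *)

theory Defs
  imports "HOL-Library.Multiset"
begin

definition pm_mset :: "int \<Rightarrow> int \<Rightarrow> int multiset" where
  "pm_mset x y = {#x, - x, y, - y#}"

definition pte3_solution :: "int multiset \<Rightarrow> int multiset \<Rightarrow> bool" where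
  "pte3_solution A B \<longleftrightarrow>
     size A = 4 \<and> size B = 4 \<and>
     (\<forall>l \<in> {1, 2, 3 :: nat}. (\<Sum>a\<in>#A. a ^ l) = (\<Sum>b\<in>#B. b ^ l))"

definition nontrivial_pte3_solution :: "int multiset \<Rightarrow> int multiset \<Rightarrow> bool" where
  "nontrivial_pte3_solution A B \<longleftrightarrow> pte3_solution A B \<and> A \<noteq> B"

end

theory Submission
  imports Defs
begin

text \<open>Odd power sums vanish by the symmetry x -> -x. For squares, both sides equal
  2(p^2+1)(r^2+1), the two ways of writing (p^2+1)(r^2+1) as a sum of two squares by Brahmagupta's
  identity. The multisets differ because the largest element of \<open>B\<close> exceeds all of
  \<open>A\<close>.\<close>

theorem proposition3p1:
  fixes p r :: int and A B :: "int multiset"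
  assumes "p > r" and "r \<ge> 2"
    and "A = pm_mset (p * r - 1) (p + r)"
    and "B = pm_mset (p * r + 1) (p - r)"
  shows "nontrivial_pte3_solution A B"
proof -
  have "pte3_solution A B"
    unfolding assms(3,4) pte3_solution_def pm_mset_def
    by (simp add: power2_eq_square power3_eq_cube algebra_simps)
  moreover have "A \<noteq> B"
  proof -
    \<comment> \<open>Expanded, this says that \<open>p * r + 1\<close> beats \<open>p + r\<close>,
      its only serious rival in \<open>A\<close>.\<close>
    have "(p - 1) * (r - 1) > 0"
      using assms(1,2) by simp
    then have "p * r + 1 > p + r"
      by (simp add: algebra_simps)
    then have "p * r + 1 \<notin># A"
      using assms(1,2) unfolding assms(3) pm_mset_def by auto
    moreover have "p * r + 1 \<in># B"
      unfolding assms(4) pm_mset_def by simp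
    ultimately show ?thesis
      by auto
  qed
  ultimately show ?thesis
    unfolding nontrivial_pte3_solution_def by blast
qed

end
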